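(* If $V^1 \cap V^2 = \emptyset$, then $\mathcal{T}_{\mathcal{P}_1, \dots ,\mathcal{P}_{n+m}} \cong \mathcal{T}_{\mathcal{P}^1_1, \dots ,\mathcal{P}^1_n} \mathbin{|||} \mathcal{T}_{\mathcal{P}^2_1, \dots ,\mathcal{P}^2_m}$.
   Context: Let $\mathcal{P}^1=(\mathcal{P}^1_1,\dots,\mathcal{P}^1_n)$ and $\mathcal{P}^2=(\mathcal{P}^2_1,\dots,\mathcal{P}^2_m)$ be shared-variable systems (tuples of program graphs) over a set of variables $Var$, and let $(\mathcal{P}_1,\dots,\mathcal{P}_{n+m})$ be their parallel composition, i.e. $\mathcal{P}_i=\mathcal{P}^1_i$ for $i\le n$ and $\mathcal{P}_i=\mathcal{P}^2_{i-n}$ for $i>n$. $V^1$, $V^2$ denote the sets of declared variables (unions of the declared variables of the component program graphs) of $\mathcal{P}^1$, $\mathcal{P}^2$. Fix an initial evaluation $\eta_0\in Ev(Var)$, and let $\mathcal{T}_{\dots}$ denote the $\ltimes$-transition system model of a shared-variable system w.r.t. $\eta_0$: its states are reachable tuples (locations of each process, evaluation of declared variables), edges are transitions of a single process enabled by its guard, labels are pairs (process ID, action), and $(i,a)\ltimes(j,b)$ iff $i<j$. For $\ltimes$-transition systems $\mathcal{S},\mathcal{T}$, the interleaving $\mathcal{S}\mathbin{|||}\mathcal{T}$ is the $\ltimes$-transition system whose underlying transition system is the 1-skeleton of the HDA tensor product $U(\mathcal{S})\otimes U(\mathcal{T})$ (label set $\Sigma_\mathcal{S}\amalg\Sigma_\mathcal{T}$),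 with $\alpha\ltimes\beta$ iff either $\alpha,\beta\in\Sigma_\mathcal{S}$ and $\alpha\ltimes_\mathcal{S}\beta$, or $\alpha,\beta\in\Sigma_\mathcal{T}$ and $\alpha\ltimes_\mathcal{T}\beta$, or $\alpha\in\Sigma_\mathcal{S}$ and $\beta\in\Sigma_\mathcal{T}$. Isomorphism is in the category of $\ltimes$-transition systems (HDA morphisms compatible with the relations). *)

theory Defs
  imports Main "HOL-Library.FuncSet"
begin

section \<open>Precubical sets\<close>

text \<open>A graded set is a set of cubes with a degree function. The boundary operator
  $d^k_i$ is \<open>bd k i\<close>; it is only meaningful for $k \in \{0,1\}$ and
  $1 \le i \le \deg x$.\<close>

record 'c precubical =
  cubes :: "'c set"
  deg :: "'c \<Rightarrow> nat"
  bd :: "nat \<Rightarrow> nat \<Rightarrow> 'c \<Rightarrow> 'c"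

definition cubes_of_degree :: "'c precubical \<Rightarrow> nat \<Rightarrow> 'c set" where
  "cubes_of_degree P n = {x \<in> cubes P. deg P x = n}"

definition precubical_set :: "'c precubical \<Rightarrow> bool" where
  "precubical_set P \<longleftrightarrow>
     (\<forall>x\<in>cubes P. \<forall>k\<in>{0,1}. \<forall>i\<in>{1..deg P x}.
        bd P k i x \<in> cubes P \<and> Suc (deg P (bd P k i x)) = deg P x) \<and>
     (\<forall>x\<in>cubes P. \<forall>k\<in>{0,1}. \<forall>l\<in>{0,1}. \<forall>i\<in>{1..deg P x}. \<forall>j\<in>{1..deg P x}.
        i < j \<longrightarrow> bd P k i (bd P l j x) = bd P l (j - 1) (bd P k i x))"

definition precubical_morphism :: "'c precubical \<Rightarrow> 'd precubical \<Rightarrow> ('c \<Rightarrow> 'd) \<Rightarrow> bool" where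
  "precubical_morphism P Q f \<longleftrightarrow>
     (\<forall>x\<in>cubes P. f x \<in> cubes Q \<and> deg Q (f x) = deg P x) \<and>
     (\<forall>x\<in>cubes P. \<forall>k\<in>{0,1}. \<forall>i\<in>{1..deg P x}. f (bd P k i x) = bd Q k i (f x))"

definition precubical_tensor :: "'c precubical \<Rightarrow> 'd precubical \<Rightarrow> ('c \<times> 'd) precubical" where
  "precubical_tensor P Q =
     \<lparr> cubes = cubes P \<times> cubes Q,
       deg = (\<lambda>(x, y). deg P x + deg Q y),
       bd = (\<lambda>k i (x, y). if i \<le> deg P x then (bd P k i x, y)
                          else (x, bd Q k (i - deg P x) y)) \<rparr>"

definition precubical_skeleton :: "nat \<Rightarrow> 'c precubical \<Rightarrow> 'c precubical" where
  "precubical_skeleton n P = P\<lparr> cubes := {x \<in> cubes P. deg P x \<le> n} \<rparr>"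


section \<open>Higher-dimensional automata\<close>

record ('c, 'l) hda =
  underlying :: "'c precubical"
  initial :: "'c set"
  final :: "'c set"
  alphabet :: "'l set"
  label :: "'c \<Rightarrow> 'l"

definition HDA :: "('c, 'l) hda \<Rightarrow> bool" where
  "HDA A \<longleftrightarrow>
     precubical_set (underlying A) \<and>
     initial A \<subseteq> cubes_of_degree (underlying A) 0 \<and>
     final A \<subseteq> cubes_of_degree (underlying A) 0 \<and>
     (\<forall>x\<in>cubes_of_degree (underlying A) 1. label A x \<in> alphabet A) \<and>
     (\<forall>x\<in>cubes_of_degree (underlying A) 2. \<forall>i\<in>{1,2}.
        label A (bd (underlying A) 0 i x) = label A (bd (underlying A) 1 i x))"

definition hda_morphism ::
  "('c, 'l) hda \<Rightarrow> ('d, 'm) hda \<Rightarrow> ('c \<Rightarrow> 'd) \<Rightarrow> ('l \<Rightarrow> 'm) \<Rightarrow> bool" where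
  "hda_morphism A B f \<sigma> \<longleftrightarrow>
     precubical_morphism (underlying A) (underlying B) f \<and>
     (\<forall>a\<in>alphabet A. \<sigma> a \<in> alphabet B) \<and>
     f ` initial A \<subseteq> initial B \<and>
     f ` final A \<subseteq> final B \<and>
     (\<forall>x\<in>cubes_of_degree (underlying A) 1. label B (f x) = \<sigma> (label A x))"

definition hda_tensor :: "('c, 'l) hda \<Rightarrow> ('d, 'm) hda \<Rightarrow> ('c \<times> 'd, 'l + 'm) hda" where
  "hda_tensor A B =
     \<lparr> underlying = precubical_tensor (underlying A) (underlying B),
       initial = initial A \<times> initial B,
       final = final A \<times> final B,
       alphabet = alphabet A <+> alphabet B,
       label = (\<lambda>(x, y). if deg (underlying A) x = 1 then Inl (label A x) else Inr (label B y)) \<rparr>"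

definition hda_skeleton :: "nat \<Rightarrow> ('c, 'l) hda \<Rightarrow> ('c, 'l) hda" where
  "hda_skeleton n A = A\<lparr> underlying := precubical_skeleton n (underlying A) \<rparr>"

definition extensional_hda :: "('c, 'l) hda \<Rightarrow> bool" where
  "extensional_hda A \<longleftrightarrow>
     (\<forall>x\<in>cubes_of_degree (underlying A) 1. \<forall>y\<in>cubes_of_degree (underlying A) 1.
        (\<forall>k\<in>{0,1}. bd (underlying A) k 1 x = bd (underlying A) k 1 y) \<and>
        label A x = label A y \<longrightarrow> x = y)"

definition transition_system :: "('c, 'l) hda \<Rightarrow> bool" where
  "transition_system A \<longleftrightarrow>
     HDA A \<and> (\<forall>x\<in>cubes (underlying A). deg (underlying A) x \<le> 1) \<and> extensional_hda A"


section \<open>Transition systems with a relation on the alphabet\<close>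

text \<open>The field \<open>ltimes\<close> is the relation $\ltimes$; the field \<open>U\<close> is the forgetful functor to HDAs.\<close>

record ('c, 'l) lts =
  U :: "('c, 'l) hda"
  ltimes :: "('l \<times> 'l) set"

definition ltimes_transition_system :: "('c, 'l) lts \<Rightarrow> bool" where
  "ltimes_transition_system S \<longleftrightarrow>
     transition_system (U S) \<and> ltimes S \<subseteq> alphabet (U S) \<times> alphabet (U S)"

definition ltimes_morphism ::
  "('c, 'l) lts \<Rightarrow> ('d, 'm) lts \<Rightarrow> ('c \<Rightarrow> 'd) \<Rightarrow> ('l \<Rightarrow> 'm) \<Rightarrow> bool" where
  "ltimes_morphism S T f \<sigma> \<longleftrightarrow>
     hda_morphism (U S) (U T) f \<sigma> \<and>
     (\<forall>a b. (a, b) \<in> ltimes S \<longrightarrow> (\<sigma> a, \<sigma> b) \<in> ltimes T)"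

text \<open>Morphisms are represented by total functions, so two of them are identified when they
  agree on the cubes and on the labels; the inverse laws are stated accordingly.\<close>

definition ltimes_isomorphic :: "('c, 'l) lts \<Rightarrow> ('d, 'm) lts \<Rightarrow> bool" (infix "\<cong>\<^sub>\<ltimes>" 50) where
  "S \<cong>\<^sub>\<ltimes> T \<longleftrightarrow>
     ltimes_transition_system S \<and> ltimes_transition_system T \<and>
     (\<exists>f \<sigma> g \<tau>. ltimes_morphism S T f \<sigma> \<and> ltimes_morphism T S g \<tau> \<and>
        (\<forall>x\<in>cubes (underlying (U S)). g (f x) = x) \<and>
        (\<forall>a\<in>alphabet (U S). \<tau> (\<sigma> a) = a) \<and>
        (\<forall>y\<in>cubes (underlying (U T)). f (g y) = y) \<and>
        (\<forall>b\<in>alphabet (U T). \<sigma> (\<tau> b) = b))"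

definition interleaving ::
  "('c, 'l) lts \<Rightarrow> ('d, 'm) lts \<Rightarrow> ('c \<times> 'd, 'l + 'm) lts" (infixr "|||" 65) where
  "S ||| T =
     \<lparr> U = hda_skeleton 1 (hda_tensor (U S) (U T)),
       ltimes = {(Inl a, Inl b) | a b. (a, b) \<in> ltimes S} \<union>
                {(Inr a, Inr b) | a b. (a, b) \<in> ltimes T} \<union>
                {(Inl a, Inr b) | a b. a \<in> alphabet (U S) \<and> b \<in> alphabet (U T)} \<rparr>"


section \<open>Program graphs and shared-variable systems\<close>

text \<open>\<open>D v\<close> is the domain of the variable \<open>v\<close>.\<close>

definition Ev :: "('v \<Rightarrow> 'd set) \<Rightarrow> 'v set \<Rightarrow> ('v \<Rightarrow> 'd) set" where
  "Ev D V = (\<Pi>\<^sub>E v\<in>V. D v)"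

text \<open>A condition (guard) on the declared variables is represented by the set of evaluations
  satisfying it.\<close>

record ('v, 'd, 'l, 'a) program_graph =
  declared :: "'v set"
  locations :: "'l set"
  actions :: "'a set"
  effect :: "'a \<Rightarrow> ('v \<Rightarrow> 'd) \<Rightarrow> ('v \<Rightarrow> 'd)"
  transitions :: "('l \<times> ('v \<Rightarrow> 'd) set \<times> 'a \<times> 'l) set"
  initial_locations :: "'l set"
  final_locations :: "'l set"

definition program_graph_over ::
  "('v \<Rightarrow> 'd set) \<Rightarrow> 'v set \<Rightarrow> ('v, 'd, 'l, 'a) program_graph \<Rightarrow> bool" where
  "program_graph_over D Var P \<longleftrightarrow>
     declared P \<subseteq> Var \<and>
     (\<forall>a\<in>actions P. effect P a \<in> Ev D (declared P) \<rightarrow> Ev D (declared P)) \<and>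
     transitions P \<subseteq> locations P \<times> Pow (Ev D (declared P)) \<times> actions P \<times> locations P \<and>
     initial_locations P \<subseteq> locations P \<and>
     final_locations P \<subseteq> locations P"

text \<open>The parallel composition of two shared-variable systems is list concatenation.\<close>

definition shared_variable_system ::
  "('v \<Rightarrow> 'd set) \<Rightarrow> 'v set \<Rightarrow> ('v, 'd, 'l, 'a) program_graph list \<Rightarrow> bool" where
  "shared_variable_system D Var Ps \<longleftrightarrow> (\<forall>P\<in>set Ps. program_graph_over D Var P)"

definition declared_vars :: "('v, 'd, 'l, 'a) program_graph list \<Rightarrow> 'v set" where
  "declared_vars Ps = (\<Union>P\<in>set Ps. declared P)"

type_synonym ('v, 'd, 'l) state = "'l list \<times> ('v \<Rightarrow> 'd)"

definition initial_states ::
  "('v \<Rightarrow> 'd) \<Rightarrow> ('v, 'd, 'l, 'a) program_graph list \<Rightarrow> ('v, 'd, 'l) state set" where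
  "initial_states \<eta>0 Ps =
     {(ls, restrict \<eta>0 (declared_vars Ps)) | ls. list_all2 (\<lambda>l P. l \<in> initial_locations P) ls Ps}"

text \<open>The process with ID \<open>i\<close> (counting from 0) performs the action \<open>a\<close>: the guard and the
  effect see the current values of the variables declared by that process, and only these
  variables are changed.\<close>

definition step ::
  "('v, 'd, 'l, 'a) program_graph list \<Rightarrow> ('v, 'd, 'l) state \<Rightarrow> nat \<times> 'a \<Rightarrow> ('v, 'd, 'l) state \<Rightarrow> bool"
  where
  "step Ps s ia s' \<longleftrightarrow>
     (case (s, ia, s') of ((ls, \<eta>), (i, a), (ls', \<eta>')) \<Rightarrow>
        i < length Ps \<and>
        (\<exists>g l'. (ls ! i, g, a, l') \<in> transitions (Ps ! i) \<and>
                restrict \<eta> (declared (Ps ! i)) \<in> g \<and>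
                ls' = ls[i := l'] \<and>
                \<eta>' = override_on \<eta> (effect (Ps ! i) a (restrict \<eta> (declared (Ps ! i))))
                       (declared (Ps ! i))))"

inductive_set reachable ::
  "('v \<Rightarrow> 'd) \<Rightarrow> ('v, 'd, 'l, 'a) program_graph list \<Rightarrow> ('v, 'd, 'l) state set"
  for \<eta>0 Ps where
  init: "s \<in> initial_states \<eta>0 Ps \<Longrightarrow> s \<in> reachable \<eta>0 Ps"
| step: "s \<in> reachable \<eta>0 Ps \<Longrightarrow> step Ps s ia s' \<Longrightarrow> s' \<in> reachable \<eta>0 Ps"

datatype ('s, 'l) ts_cube = State 's | Edge (src: 's) (lab: 'l) (tgt: 's)

definition model ::
  "('v \<Rightarrow> 'd) \<Rightarrow> ('v, 'd, 'l, 'a) program_graph list \<Rightarrow>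
     ((('v, 'd, 'l) state, nat \<times> 'a) ts_cube, nat \<times> 'a) lts" where
  "model \<eta>0 Ps =
     \<lparr> U =
         \<lparr> underlying =
             \<lparr> cubes = State ` reachable \<eta>0 Ps \<union>
                 {Edge s ia s' | s ia s'. s \<in> reachable \<eta>0 Ps \<and> step Ps s ia s'},
               deg = (\<lambda>c. case c of State s \<Rightarrow> 0 | Edge s ia s' \<Rightarrow> 1),
               bd = (\<lambda>k i c. State (if k = 0 then src c else tgt c)) \<rparr>,
           initial = State ` initial_states \<eta>0 Ps,
           final = {State (ls, \<eta>) | ls \<eta>. (ls, \<eta>) \<in> reachable \<eta>0 Ps \<and>
                      list_all2 (\<lambda>l P. l \<in> final_locations P) ls Ps},
           alphabet = {(i, a). i < length Ps \<and> a \<in> actions (Ps ! i)},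
           label = lab \<rparr>,
       ltimes = {((i, a), (j, b)) | i a j b.
                   i < j \<and> j < length Ps \<and> a \<in> actions (Ps ! i) \<and> b \<in> actions (Ps ! j)} \<rparr>"

end

theory Submission
  imports Defs
begin

text \<open>A state of the composed system splits uniquely into a state of each subsystem: the location
  list is a concatenation and, the declared variables being disjoint, the evaluation is a disjoint
  union. A transition of one process then changes only the half of the state to which that process
  belongs, so reachable states and transitions of the composition correspond to those of the
  1-skeleton of the tensor product.\<close>

section \<open>Isomorphisms from bijections\<close>

text \<open>The inverse of a bijective morphism is a morphism as soon as initial and final cubes are
  matched by equalities and the relation by an equivalence; degrees, boundaries and labels then
  transfer by cancellation. The map goes from \<open>T\<close> to \<open>S\<close>: in the
  application \<open>T\<close> is the interleaving, and joining two states has an explicit formula,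
  whereas splitting one is left to \<open>inv_into\<close>.\<close>

lemma ltimes_isomorphic_bijI:
  assumes S: "ltimes_transition_system S" and T: "ltimes_transition_system T"
    and f: "bij_betw f (cubes (underlying (U T))) (cubes (underlying (U S)))"
    and \<sigma>: "bij_betw \<sigma> (alphabet (U T)) (alphabet (U S))"
    and deg: "\<And>x. x \<in> cubes (underlying (U T)) \<Longrightarrow>
      deg (underlying (U S)) (f x) = deg (underlying (U T)) x"
    and bd: "\<And>x k i. x \<in> cubes (underlying (U T)) \<Longrightarrow> k \<in> {0, 1} \<Longrightarrow>
      i \<in> {1..deg (underlying (U T)) x} \<Longrightarrow>
      f (bd (underlying (U T)) k i x) = bd (underlying (U S)) k i (f x)"
    and init: "f ` initial (U T) = initial (U S)"
    and final: "f ` final (U T) = final (U S)"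
    and label: "\<And>x. x \<in> cubes_of_degree (underlying (U T)) 1 \<Longrightarrow>
      label (U S) (f x) = \<sigma> (label (U T) x)"
    and ltimes: "\<And>a b. a \<in> alphabet (U T) \<Longrightarrow> b \<in> alphabet (U T) \<Longrightarrow>
      (\<sigma> a, \<sigma> b) \<in> ltimes S \<longleftrightarrow> (a, b) \<in> ltimes T"
  shows "S \<cong>\<^sub>\<ltimes> T"
proof -
  let ?CS = "cubes (underlying (U S))" and ?CT = "cubes (underlying (U T))"
  define g where "g = inv_into ?CT f"
  define \<tau> where "\<tau> = inv_into (alphabet (U T)) \<sigma>"
  have HT: "HDA (U T)" and HS: "HDA (U S)"
    using S T by (auto simp: ltimes_transition_system_def transition_system_def)
  have gf: "g (f x) = x" if "x \<in> ?CT" for x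
    using f that unfolding g_def by (simp add: bij_betw_inv_into_left)
  have fg: "f (g y) = y" if "y \<in> ?CS" for y
    using f that unfolding g_def by (simp add: bij_betw_inv_into_right)
  have gC: "g y \<in> ?CT" if "y \<in> ?CS" for y
    using f that unfolding g_def by (metis bij_betw_def inv_into_into)
  have fC: "f x \<in> ?CS" if "x \<in> ?CT" for x
    using f that by (auto simp: bij_betw_def)
  have \<tau>\<sigma>: "\<tau> (\<sigma> a) = a" if "a \<in> alphabet (U T)" for a
    using \<sigma> that unfolding \<tau>_def by (simp add: bij_betw_inv_into_left)
  have \<sigma>\<tau>: "\<sigma> (\<tau> b) = b" if "b \<in> alphabet (U S)" for b
    using \<sigma> that unfolding \<tau>_def by (simp add: bij_betw_inv_into_right)
  have \<tau>A: "\<tau> b \<in> alphabet (U T)" if "b \<in> alphabet (U S)" for b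
    using \<sigma> that unfolding \<tau>_def by (metis bij_betw_def inv_into_into)
  have \<sigma>A: "\<sigma> a \<in> alphabet (U S)" if "a \<in> alphabet (U T)" for a
    using \<sigma> that by (auto simp: bij_betw_def)
  have degg: "deg (underlying (U T)) (g y) = deg (underlying (U S)) y" if "y \<in> ?CS" for y
    using deg[OF gC[OF that]] fg[OF that] by simp
  have bdT: "bd (underlying (U T)) k i x \<in> ?CT"
    if "x \<in> ?CT" "k \<in> {0, 1}" "i \<in> {1..deg (underlying (U T)) x}" for x k i
    using HT that unfolding HDA_def precubical_set_def by blast
  \<comment> \<open>Commutation of \<open>f\<close> with boundaries is applied at
    \<open>g y\<close>. Cancelling \<open>f\<close> under \<open>g\<close> requires the boundary of
    \<open>g y\<close> to be a cube of \<open>T\<close>, which is \<open>bdT\<close>.\<close>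
  have bdg: "g (bd (underlying (U S)) k i y) = bd (underlying (U T)) k i (g y)"
    if "y \<in> ?CS" "k \<in> {0, 1}" "i \<in> {1..deg (underlying (U S)) y}" for y k i
    using bd[OF gC[OF that(1)] that(2), of i] gf[OF bdT[OF gC[OF that(1)] that(2), of i]] that
    by (simp add: degg fg)
  have ltT: "ltimes T \<subseteq> alphabet (U T) \<times> alphabet (U T)"
    and ltS: "ltimes S \<subseteq> alphabet (U S) \<times> alphabet (U S)"
    using S T by (auto simp: ltimes_transition_system_def)
  have iT: "initial (U T) \<subseteq> ?CT" and fT: "final (U T) \<subseteq> ?CT"
    using HT by (auto simp: HDA_def cubes_of_degree_def)
  have labg: "label (U T) (g y) = \<tau> (label (U S) y)"
    if "y \<in> cubes_of_degree (underlying (U S)) 1" for y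
  proof -
    have y: "y \<in> ?CS" and "g y \<in> cubes_of_degree (underlying (U T)) 1"
      using that gC degg by (auto simp: cubes_of_degree_def)
    then show ?thesis
      using label[of "g y"] \<tau>\<sigma>[of "label (U T) (g y)"] HT fg[OF y] by (auto simp: HDA_def)
  qed
  have "ltimes_morphism T S f \<sigma>"
    unfolding ltimes_morphism_def hda_morphism_def precubical_morphism_def
    using fC deg bd \<sigma>A init final label ltimes ltT by (auto 0 3)
  moreover have "ltimes_morphism S T g \<tau>"
    unfolding ltimes_morphism_def hda_morphism_def precubical_morphism_def
  proof (intro conjI ballI allI impI)
    show "g ` initial (U S) \<subseteq> initial (U T)" "g ` final (U S) \<subseteq> final (U T)"
      using gf iT fT by (auto simp flip: init final simp: subset_iff)
    show "(\<tau> a, \<tau> b) \<in> ltimes T" if "(a, b) \<in> ltimes S" for a b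
      using ltimes[of "\<tau> a" "\<tau> b"] that \<tau>A \<sigma>\<tau> ltS by auto
  qed (simp_all add: gC degg bdg \<tau>A labg del: atLeastAtMost_iff)
  ultimately show ?thesis
    unfolding ltimes_isomorphic_def using S T gf fg \<tau>\<sigma> \<sigma>\<tau> by blast
qed

section \<open>Transition systems and their interleaving\<close>

text \<open>In degree at most 1 the only boundary index is 1, so the precubical identity has no
  instance \<open>i < j\<close>, and the condition on the labels of squares is vacuous. Boundaries
  of edges are all that remains to check.\<close>

lemma transition_systemI:
  assumes bd: "\<And>x k. x \<in> cubes (underlying A) \<Longrightarrow> deg (underlying A) x = 1 \<Longrightarrow> k \<in> {0, 1} \<Longrightarrow>
      bd (underlying A) k 1 x \<in> cubes_of_degree (underlying A) 0"
    and deg: "\<And>x. x \<in> cubes (underlying A) \<Longrightarrow> deg (underlying A) x \<le> 1"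
    and "initial A \<subseteq> cubes_of_degree (underlying A) 0"
    and "final A \<subseteq> cubes_of_degree (underlying A) 0"
    and "\<And>x. x \<in> cubes_of_degree (underlying A) 1 \<Longrightarrow> label A x \<in> alphabet A"
    and "extensional_hda A"
  shows "transition_system A"
proof -
  have one: "i = 1 \<and> deg (underlying A) x = 1"
    if "x \<in> cubes (underlying A)" "i \<in> {1..deg (underlying A) x}" for x i
    using deg[OF that(1)] that(2) by auto
  have "precubical_set (underlying A)"
    unfolding precubical_set_def
  proof (intro conjI ballI impI)
    fix x k i assume x: "x \<in> cubes (underlying A)" "k \<in> {0, 1::nat}" "i \<in> {1..deg (underlying A) x}"
    show "bd (underlying A) k i x \<in> cubes (underlying A)"
      "Suc (deg (underlying A) (bd (underlying A) k i x)) = deg (underlying A) x"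
      using bd[OF x(1) _ x(2)] one[OF x(1,3)] by (auto simp: cubes_of_degree_def)
  next
    fix x k l i j
    assume "x \<in> cubes (underlying A)" "i \<in> {1..deg (underlying A) x}"
      "j \<in> {1..deg (underlying A) x}" "i < j"
    then show "bd (underlying A) k i (bd (underlying A) l j x) =
      bd (underlying A) l (j - 1) (bd (underlying A) k i x)"
      using one[of x i] one[of x j] by simp
  qed
  moreover have "cubes_of_degree (underlying A) 2 = {}"
    using deg by (force simp: cubes_of_degree_def)
  ultimately show ?thesis
    using assms by (simp add: transition_system_def HDA_def)
qed

text \<open>An edge of the 1-skeleton is an edge of one factor paired with a vertex of the other, so
  every condition reduces to the factor that contributes the edge.\<close>

lemma ltimes_transition_system_interleaving:
  assumes "ltimes_transition_system S" "ltimes_transition_system T"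
  shows "ltimes_transition_system (S ||| T)"
proof -
  let ?A = "U S" and ?B = "U T"
  let ?P = "underlying ?A" and ?Q = "underlying ?B"
  let ?R = "underlying (U (S ||| T))"
  have A: "HDA ?A" "extensional_hda ?A" and B: "HDA ?B" "extensional_hda ?B"
    using assms by (auto simp: ltimes_transition_system_def transition_system_def)
  have cubes: "(x, y) \<in> cubes ?R \<longleftrightarrow> x \<in> cubes ?P \<and> y \<in> cubes ?Q \<and> deg ?P x + deg ?Q y \<le> 1"
    and deg: "deg ?R (x, y) = deg ?P x + deg ?Q y"
    and bd: "bd ?R k i (x, y) =
      (if i \<le> deg ?P x then (bd ?P k i x, y) else (x, bd ?Q k (i - deg ?P x) y))"
    and lab: "label (U (S ||| T)) (x, y) = (if deg ?P x = 1 then Inl (label ?A x) else Inr (label ?B y))"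
    for x y k i
    by (auto simp: interleaving_def hda_skeleton_def precubical_skeleton_def hda_tensor_def
        precubical_tensor_def)
  have init: "initial (U (S ||| T)) = initial ?A \<times> initial ?B"
    and final: "final (U (S ||| T)) = final ?A \<times> final ?B"
    and alph: "alphabet (U (S ||| T)) = alphabet ?A <+> alphabet ?B"
    by (auto simp: interleaving_def hda_skeleton_def hda_tensor_def)
  have deg1: "deg ?P x = 1 \<and> deg ?Q y = 0 \<or> deg ?P x = 0 \<and> deg ?Q y = 1"
    if "(x, y) \<in> cubes_of_degree ?R 1" for x y
    using that by (auto simp: cubes_of_degree_def deg)
  have bdA: "bd ?P k 1 x \<in> cubes ?P \<and> deg ?P (bd ?P k 1 x) = 0"
    if "x \<in> cubes ?P" "deg ?P x = 1" "k \<in> {0, 1}" for x k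
  proof -
    have "bd ?P k 1 x \<in> cubes ?P \<and> Suc (deg ?P (bd ?P k 1 x)) = deg ?P x"
      using A(1) that unfolding HDA_def precubical_set_def by auto
    then show ?thesis using that by simp
  qed
  have bdB: "bd ?Q k 1 x \<in> cubes ?Q \<and> deg ?Q (bd ?Q k 1 x) = 0"
    if "x \<in> cubes ?Q" "deg ?Q x = 1" "k \<in> {0, 1}" for x k
  proof -
    have "bd ?Q k 1 x \<in> cubes ?Q \<and> Suc (deg ?Q (bd ?Q k 1 x)) = deg ?Q x"
      using B(1) that unfolding HDA_def precubical_set_def by auto
    then show ?thesis using that by simp
  qed
  have initA: "x \<in> cubes ?P \<and> deg ?P x = 0" if "x \<in> initial ?A \<or> x \<in> final ?A" for x
    using A(1) that by (auto simp: HDA_def cubes_of_degree_def)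
  have initB: "y \<in> cubes ?Q \<and> deg ?Q y = 0" if "y \<in> initial ?B \<or> y \<in> final ?B" for y
    using B(1) that by (auto simp: HDA_def cubes_of_degree_def)
  have "transition_system (U (S ||| T))"
  proof (rule transition_systemI)
    fix p k assume "p \<in> cubes ?R" "deg ?R p = 1" "k \<in> {0, 1::nat}"
    moreover obtain x y where "p = (x, y)" by fastforce
    ultimately show "bd ?R k 1 p \<in> cubes_of_degree ?R 0"
      using deg1[of x y] bdA[of x k] bdB[of y k]
      by (auto simp: cubes_of_degree_def cubes deg bd)
  next
    show "extensional_hda (U (S ||| T))"
      unfolding extensional_hda_def
    proof (intro ballI impI)
      fix p q
      assume p: "p \<in> cubes_of_degree ?R 1" and q: "q \<in> cubes_of_degree ?R 1"
        and eq: "(\<forall>k\<in>{0, 1}. bd ?R k 1 p = bd ?R k 1 q) \<and> label (U (S ||| T)) p = label (U (S ||| T)) q"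
      obtain x y where xy: "p = (x, y)" by fastforce
      obtain x' y' where xy': "q = (x', y')" by fastforce
      have mem: "x \<in> cubes ?P" "x' \<in> cubes ?P" "y \<in> cubes ?Q" "y' \<in> cubes ?Q"
        using p q by (auto simp: cubes_of_degree_def cubes xy xy')
      \<comment> \<open>Equal labels lie in the same summand, which rules out an edge from the left
        factor against one from the right. In each remaining case the boundaries also determine the
        vertex component.\<close>
      consider "deg ?P x = 1" "deg ?P x' = 1" | "deg ?Q y = 1" "deg ?Q y' = 1"
        "deg ?P x = 0" "deg ?P x' = 0"
        using deg1[of x y] deg1[of x' y'] p q eq
        by (auto simp: xy xy' lab)
      then show "p = q"
      proof cases
        case 1
        then have "x \<in> cubes_of_degree ?P 1" "x' \<in> cubes_of_degree ?P 1"
          using mem by (auto simp: cubes_of_degree_def)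
        then show ?thesis
          using A(2) eq 1 unfolding extensional_hda_def xy xy' bd lab by (auto split: if_splits)
      next
        case 2
        then have "y \<in> cubes_of_degree ?Q 1" "y' \<in> cubes_of_degree ?Q 1"
          using mem by (auto simp: cubes_of_degree_def)
        then show ?thesis
          using B(2) eq 2 unfolding extensional_hda_def xy xy' bd lab by (auto split: if_splits)
      qed
    qed
  next
    fix p assume "p \<in> cubes_of_degree ?R 1"
    moreover obtain x y where "p = (x, y)" by fastforce
    ultimately show "label (U (S ||| T)) p \<in> alphabet (U (S ||| T))"
      using A(1) B(1) deg1[of x y]
      by (auto simp: HDA_def cubes_of_degree_def cubes lab alph)
  next
    show "initial (U (S ||| T)) \<subseteq> cubes_of_degree ?R 0"
      "final (U (S ||| T)) \<subseteq> cubes_of_degree ?R 0"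
      by (auto simp: cubes_of_degree_def init final cubes deg initA initB)
  qed (auto simp: cubes deg)
  moreover have "ltimes (S ||| T) \<subseteq> alphabet (U (S ||| T)) \<times> alphabet (U (S ||| T))"
    using assms unfolding alph by (auto simp: ltimes_transition_system_def interleaving_def)
  ultimately show ?thesis
    by (simp add: ltimes_transition_system_def)
qed

section \<open>The model of a single system\<close>

lemma reachable_initial_states: "initial_states \<eta>0 Ps \<subseteq> reachable \<eta>0 Ps"
  by (auto intro: reachable.init)

text \<open>Edges of the model are arbitrary steps, while its alphabet contains only declared
  actions; the typing of the transitions of a program graph bridges the two.\<close>

lemma step_in_actions:
  assumes "shared_variable_system D Var Ps" "step Ps s (i, a) s'"
  shows "i < length Ps" "a \<in> actions (Ps ! i)"
proof -
  show i: "i < length Ps" using assms(2) by (auto simp: step_def)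
  then have "program_graph_over D Var (Ps ! i)"
    using assms(1) by (simp add: shared_variable_system_def)
  then show "a \<in> actions (Ps ! i)"
    using assms(2) by (auto simp: step_def program_graph_over_def)
qed

text \<open>Extensionality is built in: an edge is recorded as its source, label and target.\<close>

lemma ltimes_transition_system_model:
  assumes "shared_variable_system D Var Ps"
  shows "ltimes_transition_system (model \<eta>0 Ps)"
proof -
  have "transition_system (U (model \<eta>0 Ps))"
    using reachable_initial_states[of \<eta>0 Ps] step_in_actions[OF assms]
    by (intro transition_systemI)
      (auto simp: model_def cubes_of_degree_def extensional_hda_def intro: reachable.step)
  then show ?thesis
    by (auto simp: ltimes_transition_system_def model_def)
qed

section \<open>Joining states, labels and cubes\<close>

text \<open>An invariant of reachable states, just strong enough for joined states to be separable:
  the length fixes where a concatenation is cut, and extensionality fixes the value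
  \<open>undefined\<close> outside the declared variables.\<close>

definition valid_states :: "('v, 'd, 'l, 'a) program_graph list \<Rightarrow> ('v, 'd, 'l) state set" where
  "valid_states Ps = {(ls, \<eta>). length ls = length Ps \<and> \<eta> \<in> extensional (declared_vars Ps)}"

lemma declared_subset_declared_vars: "i < length Ps \<Longrightarrow> declared (Ps ! i) \<subseteq> declared_vars Ps"
  by (simp add: declared_vars_def UN_upper)

text \<open>A step updates one position of the location list and writes only to variables declared
  by one process of the system.\<close>

lemma reachable_valid_states: "s \<in> reachable \<eta>0 Ps \<Longrightarrow> s \<in> valid_states Ps"
proof (induction rule: reachable.induct)
  case (init s)
  then show ?case
    by (auto simp: initial_states_def valid_states_def dest: list_all2_lengthD)
next
  case (step s ia s')
  then show ?case
    using declared_subset_declared_vars[of "fst ia" Ps]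
    by (auto simp: step_def valid_states_def extensional_def override_on_def)
qed

text \<open>\<open>V\<close> is meant to be the set of declared variables of the first system.
  Outside \<open>V\<close> the evaluation of \<open>t\<close> is kept, including its default
  \<open>undefined\<close> on variables declared by neither system.\<close>

definition join_state ::
  "'v set \<Rightarrow> ('v, 'd, 'l) state \<Rightarrow> ('v, 'd, 'l) state \<Rightarrow> ('v, 'd, 'l) state" where
  "join_state V s t = (fst s @ fst t, override_on (snd t) (snd s) V)"

text \<open>With \<open>n\<close> the number of processes of the first system, the shift by
  \<open>n\<close> follows the positions in the concatenated list; IDs count from 0.\<close>

fun join_label :: "nat \<Rightarrow> (nat \<times> 'a) + (nat \<times> 'a) \<Rightarrow> nat \<times> 'a" where
  "join_label n (Inl (i, a)) = (i, a)"
| "join_label n (Inr (i, a)) = (n + i, a)"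

text \<open>Pairs of edges are cubes of degree 2, hence absent from the 1-skeleton; their value is
  irrelevant.\<close>

fun join_cube ::
  "nat \<Rightarrow> 'v set \<Rightarrow> (('v, 'd, 'l) state, nat \<times> 'a) ts_cube \<times> (('v, 'd, 'l) state, nat \<times> 'a) ts_cube
     \<Rightarrow> (('v, 'd, 'l) state, nat \<times> 'a) ts_cube" where
  "join_cube n V (State s, State t) = State (join_state V s t)"
| "join_cube n V (Edge s ia s', State t) =
     Edge (join_state V s t) (join_label n (Inl ia)) (join_state V s' t)"
| "join_cube n V (State s, Edge t ia t') =
     Edge (join_state V s t) (join_label n (Inr ia)) (join_state V s t')"
| "join_cube n V (Edge s ia s', Edge t ib t') = State (join_state V s t)"

lemma join_label_Inl: "join_label n (Inl ia) = ia"
  by (cases ia) simp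

lemma join_label_Inr: "join_label n (Inr ia) = (n + fst ia, snd ia)"
  by (cases ia) simp

locale disjoint_systems =
  fixes Ps1 Ps2 :: "('v, 'd, 'l, 'a) program_graph list"
  assumes disjoint: "declared_vars Ps1 \<inter> declared_vars Ps2 = {}"
begin

abbreviation join :: "('v, 'd, 'l) state \<Rightarrow> ('v, 'd, 'l) state \<Rightarrow> ('v, 'd, 'l) state" where
  "join \<equiv> join_state (declared_vars Ps1)"

lemma join_inject:
  assumes "s \<in> valid_states Ps1" "s' \<in> valid_states Ps1"
    and "t \<in> valid_states Ps2" "t' \<in> valid_states Ps2"
  shows "join s t = join s' t' \<longleftrightarrow> s = s' \<and> t = t'"
proof
  assume eq: "join s t = join s' t'"
  have "fst s = fst s' \<and> fst t = fst t'"
    using eq assms by (auto simp: join_state_def valid_states_def)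
  moreover have "snd s v = snd s' v \<and> snd t v = snd t' v" for v
  proof -
    have "override_on (snd t) (snd s) (declared_vars Ps1) v =
      override_on (snd t') (snd s') (declared_vars Ps1) v"
      using eq by (simp add: join_state_def)
    \<comment> \<open>A variable is declared on at most one side. On the other side its value is
      \<open>undefined\<close> in both states, and the joined evaluation reveals the side that
      matters.\<close>
    moreover have "v \<notin> declared_vars Ps1 \<or> v \<notin> declared_vars Ps2"
      using disjoint by blast
    ultimately show ?thesis
      using assms
      by (auto simp: valid_states_def extensional_def override_on_def split: if_splits)
  qed
  ultimately show "s = s' \<and> t = t'"
    by (auto simp: prod_eq_iff fun_eq_iff)
qed simp

section \<open>Steps of the composed system\<close>

text \<open>The variables of the process lie within those of \<open>Ps1\<close>: it reads the same
  values in the joined evaluation as in that of \<open>s\<close> (fact \<open>r\<close>), and its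
  writes commute with joining (fact \<open>o\<close>).\<close>

lemma step_join_left:
  assumes "s \<in> valid_states Ps1" "i < length Ps1"
  shows "step (Ps1 @ Ps2) (join s t) (i, a) u \<longleftrightarrow> (\<exists>s'. step Ps1 s (i, a) s' \<and> u = join s' t)"
proof -
  obtain ls \<eta> where s: "s = (ls, \<eta>)" by fastforce
  obtain ms \<theta> where t: "t = (ms, \<theta>)" by fastforce
  have i: "i < length ls" using assms by (simp add: s valid_states_def)
  have sub: "declared (Ps1 ! i) \<subseteq> declared_vars Ps1"
    by (rule declared_subset_declared_vars[OF assms(2)])
  have r: "restrict (override_on \<theta> \<eta> (declared_vars Ps1)) (declared (Ps1 ! i)) =
    restrict \<eta> (declared (Ps1 ! i))"
    using sub by (auto simp: fun_eq_iff override_on_def)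
  have o: "override_on (override_on \<theta> \<eta> (declared_vars Ps1)) e (declared (Ps1 ! i)) =
    override_on \<theta> (override_on \<eta> e (declared (Ps1 ! i))) (declared_vars Ps1)" for e
    using sub by (auto simp: fun_eq_iff override_on_def)
  show ?thesis
    using assms(2) i
    by (cases u) (auto simp: s t step_def join_state_def nth_append list_update_append r o)
qed

lemma step_join_right:
  assumes "s \<in> valid_states Ps1" "i < length Ps2"
  shows "step (Ps1 @ Ps2) (join s t) (length Ps1 + i, a) u \<longleftrightarrow>
    (\<exists>t'. step Ps2 t (i, a) t' \<and> u = join s t')"
proof -
  obtain ls \<eta> where s: "s = (ls, \<eta>)" by fastforce
  obtain ms \<theta> where t: "t = (ms, \<theta>)" by fastforce
  have n: "length Ps1 = length ls" using assms by (simp add: s valid_states_def)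
  \<comment> \<open>Disjointness enters here: joining overrides the second evaluation on the
    variables of \<open>Ps1\<close>, and this must not mask anything that a process of
    \<open>Ps2\<close> reads or writes.\<close>
  have sub: "declared (Ps2 ! i) \<inter> declared_vars Ps1 = {}"
    using declared_subset_declared_vars[OF assms(2)] disjoint by auto
  have r: "restrict (override_on \<theta> \<eta> (declared_vars Ps1)) (declared (Ps2 ! i)) =
    restrict \<theta> (declared (Ps2 ! i))"
    using sub by (auto simp: fun_eq_iff override_on_def)
  have o: "override_on (override_on \<theta> \<eta> (declared_vars Ps1)) e (declared (Ps2 ! i)) =
    override_on (override_on \<theta> e (declared (Ps2 ! i))) \<eta> (declared_vars Ps1)" for e
    using sub by (auto simp: fun_eq_iff override_on_def)
  show ?thesis
    using assms(2)
    by (cases u)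
      (auto simp: s t n step_def join_state_def nth_append list_update_append r[unfolded n] o)
qed

text \<open>An ID lies in the first block, in the second, or out of range. The first two cases are
  the preceding lemmas, and in the third neither side admits a step.\<close>

lemma step_join_cases:
  assumes "s \<in> valid_states Ps1"
  shows "step (Ps1 @ Ps2) (join s t) ia u \<longleftrightarrow>
    (\<exists>s'. step Ps1 s ia s' \<and> u = join s' t) \<or>
    (\<exists>ib t'. step Ps2 t ib t' \<and> ia = join_label (length Ps1) (Inr ib) \<and> u = join s t')"
proof -
  obtain i a where ia: "ia = (i, a)" by fastforce
  have lt: "j < length Ps" if "step Ps x (j, b) y"
    for Ps :: "('v, 'd, 'l, 'a) program_graph list" and x j b y
    using that by (auto simp: step_def)
  consider "i < length Ps1" | j where "i = length Ps1 + j" "j < length Ps2"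
    | "i \<ge> length Ps1 + length Ps2"
    by (metis add_less_cancel_left le_add_diff_inverse linorder_not_less)
  then show ?thesis
  proof cases
    case 1
    then show ?thesis
      using step_join_left[OF assms 1] by (auto simp: ia)
  next
    case 2
    then have "\<not> step Ps1 s (i, a) s'" for s'
      using lt[of Ps1 s i a s'] by auto
    then show ?thesis
      using step_join_right[OF assms 2(2)] by (simp add: ia 2(1))
  next
    case 3
    then have "\<not> step Ps1 s (i, a) s'" "\<not> step (Ps1 @ Ps2) (join s t) (i, a) u" for s'
      using lt[of Ps1 s i a s'] lt[of "Ps1 @ Ps2" "join s t" i a u] by auto
    moreover have "\<not> step Ps2 t (j, b) t'" if "i = length Ps1 + j" for j b t'
      using lt[of Ps2 t j b t'] 3 that by auto
    ultimately show ?thesis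
      by (auto simp: ia)
  qed
qed

section \<open>Initial and reachable states of the composition\<close>

lemma initial_states_append:
  "initial_states \<eta>0 (Ps1 @ Ps2) =
    (\<lambda>(s, t). join s t) ` (initial_states \<eta>0 Ps1 \<times> initial_states \<eta>0 Ps2)"
proof -
  let ?I = "\<lambda>Ps ls. list_all2 (\<lambda>l P. l \<in> initial_locations P) ls Ps"
  \<comment> \<open>Both evaluations are restrictions of the same \<eta>0, so they glue to its
    restriction to the union of the two variable sets.\<close>
  have eq: "join (ls, restrict \<eta>0 (declared_vars Ps1)) (ms, restrict \<eta>0 (declared_vars Ps2)) =
    (ls @ ms, restrict \<eta>0 (declared_vars (Ps1 @ Ps2)))" for ls ms
    by (auto simp: join_state_def fun_eq_iff override_on_def declared_vars_def)
  show ?thesis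
  proof (intro equalityI subsetI)
    fix u assume "u \<in> initial_states \<eta>0 (Ps1 @ Ps2)"
    then obtain ls ms where "?I Ps1 ls" "?I Ps2 ms"
      and "u = (ls @ ms, restrict \<eta>0 (declared_vars (Ps1 @ Ps2)))"
      by (auto simp: initial_states_def list_all2_append2)
    then show "u \<in> (\<lambda>(s, t). join s t) ` (initial_states \<eta>0 Ps1 \<times> initial_states \<eta>0 Ps2)"
      by (auto simp: initial_states_def image_iff simp flip: eq)
  qed (auto simp: initial_states_def eq intro: list_all2_appendI)
qed

text \<open>The two runs are executed one after the other. The base case of the outer induction lets
  the first system run up to \<open>s\<close> while \<open>t\<close> is still initial; afterwards
  \<open>s\<close> stays fixed and the second system runs.\<close>

lemma join_reachable:
  assumes "s \<in> reachable \<eta>0 Ps1" "t \<in> reachable \<eta>0 Ps2"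
  shows "join s t \<in> reachable \<eta>0 (Ps1 @ Ps2)"
  using assms(2)
proof (induction rule: reachable.induct)
  case (init t)
  show ?case
    using assms(1)
  proof (induction rule: reachable.induct)
    case (init s)
    with \<open>t \<in> initial_states \<eta>0 Ps2\<close> show ?case
      by (auto simp: initial_states_append intro!: reachable.init)
  next
    case (step s ia s')
    then show ?case
      by (meson step_join_cases reachable.step reachable_valid_states)
  qed
next
  case (step t ia t')
  then show ?case
    by (meson assms(1) step_join_cases reachable.step reachable_valid_states)
qed

text \<open>Conversely to \<open>join_reachable\<close>, a run of the composition is followed step
  by step, each step advancing exactly one of the two components.\<close>

lemma reachable_append:
  "reachable \<eta>0 (Ps1 @ Ps2) = (\<lambda>(s, t). join s t) ` (reachable \<eta>0 Ps1 \<times> reachable \<eta>0 Ps2)"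
proof (intro equalityI subsetI)
  fix u assume "u \<in> reachable \<eta>0 (Ps1 @ Ps2)"
  then show "u \<in> (\<lambda>(s, t). join s t) ` (reachable \<eta>0 Ps1 \<times> reachable \<eta>0 Ps2)"
  proof (induction rule: reachable.induct)
    case (init u)
    then show ?case
      by (auto simp: initial_states_append intro: reachable.init)
  next
    case (step u ia u')
    then obtain s t where "s \<in> reachable \<eta>0 Ps1" "t \<in> reachable \<eta>0 Ps2" "u = join s t"
      by auto
    with step.hyps show ?case
      by (auto simp: step_join_cases reachable_valid_states intro: reachable.step)
  qed
qed (auto intro: join_reachable)

section \<open>Bijections on cubes and labels\<close>

abbreviation model_cubes where
  "model_cubes \<eta>0 Ps \<equiv> cubes (underlying (U (model \<eta>0 Ps)))"

lemma cubes_model: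
  "model_cubes \<eta>0 Ps = State ` reachable \<eta>0 Ps \<union>
    {Edge s ia s' | s ia s'. s \<in> reachable \<eta>0 Ps \<and> step Ps s ia s'}"
  by (simp add: model_def)

text \<open>Of the four shapes of pairs, the degree bound leaves the three on which later case
  analyses run.\<close>

lemma cubes_interleaving:
  "cubes (underlying (U (model \<eta>0 Ps1 ||| model \<eta>0 Ps2))) =
    {(State s, State t) | s t. s \<in> reachable \<eta>0 Ps1 \<and> t \<in> reachable \<eta>0 Ps2} \<union>
    {(Edge s ia s', State t) | s ia s' t.
      s \<in> reachable \<eta>0 Ps1 \<and> step Ps1 s ia s' \<and> t \<in> reachable \<eta>0 Ps2} \<union>
    {(State s, Edge t ia t') | s t ia t'.
      s \<in> reachable \<eta>0 Ps1 \<and> t \<in> reachable \<eta>0 Ps2 \<and> step Ps2 t ia t'}"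
  by (auto simp: model_def interleaving_def hda_skeleton_def precubical_skeleton_def
      hda_tensor_def precubical_tensor_def)

text \<open>Injectivity comes from that of \<open>join\<close>, surjectivity from
  \<open>reachable_append\<close> for states and \<open>step_join_cases\<close> for edges.\<close>

lemma bij_betw_join_cube:
  "bij_betw (join_cube (length Ps1) (declared_vars Ps1))
    (cubes (underlying (U (model \<eta>0 Ps1 ||| model \<eta>0 Ps2)))) (model_cubes \<eta>0 (Ps1 @ Ps2))"
  (is "bij_betw ?f ?A ?B")
proof -
  let ?V1 = "valid_states Ps1" and ?V2 = "valid_states Ps2"
  \<comment> \<open>A superset of \<open>?A\<close> that retains only what injectivity uses. The
    bound on \<open>fst ia\<close> keeps edges of the first system apart from those of the second,
    whose shifted IDs are at least \<open>length Ps1\<close>.\<close>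
  let ?A' = "{(State s, State t) | s t. s \<in> ?V1 \<and> t \<in> ?V2} \<union>
    {(Edge s ia s', State t) | s ia s' t. s \<in> ?V1 \<and> s' \<in> ?V1 \<and> t \<in> ?V2 \<and> fst ia < length Ps1} \<union>
    {(State s, Edge t ia t') | s t ia t'. s \<in> ?V1 \<and> t \<in> ?V2 \<and> t' \<in> ?V2}"
  have valid: "s' \<in> valid_states Ps"
    if "s \<in> reachable \<eta>0 Ps" "step Ps s ia s'" for s ia s'
      and Ps :: "('v, 'd, 'l, 'a) program_graph list"
    using that by (meson reachable.step reachable_valid_states)
  have lt: "fst ia < length Ps1" if "step Ps1 s ia s'" for s ia s'
    using that by (auto simp: step_def)
  have "?A \<subseteq> ?A'"
    unfolding cubes_interleaving by (intro Un_mono; blast intro: valid lt reachable_valid_states)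
  moreover have "inj_on ?f ?A'"
    unfolding inj_on_def by (auto simp: join_inject join_label_Inl join_label_Inr)
  ultimately have "inj_on ?f ?A"
    by (rule inj_on_subset[rotated])
  moreover have "?f ` ?A = ?B"
  proof (intro equalityI subsetI)
    have mem: "State u \<in> ?B \<longleftrightarrow> u \<in> reachable \<eta>0 (Ps1 @ Ps2)"
      "Edge u ia u' \<in> ?B \<longleftrightarrow> u \<in> reachable \<eta>0 (Ps1 @ Ps2) \<and> step (Ps1 @ Ps2) u ia u'" for u ia u'
      unfolding cubes_model by blast+
    have steps: "step Ps1 s ia s' \<Longrightarrow> step (Ps1 @ Ps2) (join s t) ia (join s' t)"
      "step Ps2 t ia t' \<Longrightarrow>
        step (Ps1 @ Ps2) (join s t) (join_label (length Ps1) (Inr ia)) (join s t')"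
      if "s \<in> valid_states Ps1" for s s' t t' ia
      using step_join_cases[OF that] by blast+
    fix y assume "y \<in> ?f ` ?A"
    then show "y \<in> ?B"
      unfolding cubes_interleaving
      by (auto simp: mem join_label_Inl steps reachable_valid_states join_reachable
          simp del: join_label.simps)
  next
    fix y assume "y \<in> ?B"
    \<comment> \<open>Any reachable source is a join by \<open>reachable_append\<close>; for an
      edge, the target is decomposed below according to the side that moved.\<close>
    then consider s t where "y = State (join s t)" "s \<in> reachable \<eta>0 Ps1" "t \<in> reachable \<eta>0 Ps2"
      | s t ia u where "y = Edge (join s t) ia u" "s \<in> reachable \<eta>0 Ps1" "t \<in> reachable \<eta>0 Ps2"
        "step (Ps1 @ Ps2) (join s t) ia u"
      unfolding cubes_model reachable_append by auto
    then show "y \<in> ?f ` ?A"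
    proof cases
      case 1
      then have "(State s, State t) \<in> ?A" "y = ?f (State s, State t)"
        unfolding cubes_interleaving by (blast, simp)
      then show ?thesis by blast
    next
      case st: 2
      from st(4) consider s' where "step Ps1 s ia s'" "u = join s' t"
        | ib t' where "step Ps2 t ib t'" "ia = join_label (length Ps1) (Inr ib)" "u = join s t'"
        unfolding step_join_cases[OF reachable_valid_states[OF st(2)]] by blast
      then show ?thesis
      proof cases
        case 1
        then have "(Edge s ia s', State t) \<in> ?A" "y = ?f (Edge s ia s', State t)"
          unfolding cubes_interleaving using st by (blast, simp add: join_label_Inl)
        then show ?thesis by blast
      next
        case 2
        then have "(State s, Edge t ib t') \<in> ?A" "y = ?f (State s, Edge t ib t')"
          unfolding cubes_interleaving using st by (blast, simp)
        then show ?thesis by blast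
      qed
    qed
  qed
  ultimately show ?thesis by (simp add: bij_betw_def)
qed

lemma bij_betw_join_label:
  "bij_betw (join_label (length Ps1)) (alphabet (U (model \<eta>0 Ps1 ||| model \<eta>0 Ps2)))
    (alphabet (U (model \<eta>0 (Ps1 @ Ps2))))"
  (is "bij_betw ?f ?A ?B")
proof -
  have A: "?A = {(i, a). i < length Ps1 \<and> a \<in> actions (Ps1 ! i)} <+>
      {(i, a). i < length Ps2 \<and> a \<in> actions (Ps2 ! i)}"
    and B: "?B = {(i, a). i < length (Ps1 @ Ps2) \<and> a \<in> actions ((Ps1 @ Ps2) ! i)}"
    by (simp_all add: model_def interleaving_def hda_skeleton_def hda_tensor_def)
  have "inj_on ?f ?A"
    unfolding A inj_on_def by auto
  moreover have "?f ` ?A = ?B"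
  proof (intro equalityI subsetI)
    fix y assume "y \<in> ?B"
    then obtain i a where y: "y = (i, a)" "i < length (Ps1 @ Ps2)" "a \<in> actions ((Ps1 @ Ps2) ! i)"
      unfolding B by auto
    show "y \<in> ?f ` ?A"
    proof (cases "i < length Ps1")
      case True
      then have "y = ?f (Inl (i, a))" "Inl (i, a) \<in> ?A"
        using y by (auto simp: A nth_append)
      then show ?thesis by blast
    next
      case False
      \<comment> \<open>Undoing the shift gives the position of the process within
        \<open>Ps2\<close>.\<close>
      then have "y = ?f (Inr (i - length Ps1, a))" "Inr (i - length Ps1, a) \<in> ?A"
        using y by (auto simp: A nth_append)
      then show ?thesis by blast
    qed
  qed (auto simp: A B nth_append)
  ultimately show ?thesis by (simp add: bij_betw_def)
qed

lemma join_cube_final: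
  "join_cube (length Ps1) (declared_vars Ps1) ` final (U (model \<eta>0 Ps1 ||| model \<eta>0 Ps2)) =
    final (U (model \<eta>0 (Ps1 @ Ps2)))"
  (is "?f ` ?A = ?B")
proof -
  let ?F = "\<lambda>Ps ls. list_all2 (\<lambda>l P. l \<in> final_locations P) ls Ps"
  have A: "?A = {State s | s. s \<in> reachable \<eta>0 Ps1 \<and> ?F Ps1 (fst s)} \<times>
      {State t | t. t \<in> reachable \<eta>0 Ps2 \<and> ?F Ps2 (fst t)}"
    and B: "?B = {State u | u. u \<in> reachable \<eta>0 (Ps1 @ Ps2) \<and> ?F (Ps1 @ Ps2) (fst u)}"
    by (auto simp: model_def interleaving_def hda_skeleton_def hda_tensor_def)
  \<comment> \<open>Reachability of \<open>s\<close> gives its location list the length of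
    \<open>Ps1\<close>, so the concatenated lists are compared block by block.\<close>
  have F: "?F (Ps1 @ Ps2) (fst (join s t)) \<longleftrightarrow> ?F Ps1 (fst s) \<and> ?F Ps2 (fst t)"
    if "s \<in> reachable \<eta>0 Ps1" for s t
    using reachable_valid_states[OF that]
    by (auto simp: join_state_def valid_states_def list_all2_append)
  show ?thesis
  proof (intro equalityI subsetI)
    fix y assume "y \<in> ?B"
    then obtain u where u: "y = State u" "u \<in> reachable \<eta>0 (Ps1 @ Ps2)" "?F (Ps1 @ Ps2) (fst u)"
      unfolding B by blast
    from u(2) obtain s t where "u = join s t" "s \<in> reachable \<eta>0 Ps1" "t \<in> reachable \<eta>0 Ps2"
      unfolding reachable_append by auto
    with u have st: "y = State (join s t)" "s \<in> reachable \<eta>0 Ps1" "t \<in> reachable \<eta>0 Ps2"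
      "?F (Ps1 @ Ps2) (fst (join s t))"
      by auto
    then have "?F Ps1 (fst s)" "?F Ps2 (fst t)"
      using F by auto
    then have "(State s, State t) \<in> ?A" "y = ?f (State s, State t)"
      unfolding A using st by (blast, simp)
    then show "y \<in> ?f ` ?A" by blast
  next
    have mem: "State u \<in> ?B \<longleftrightarrow> u \<in> reachable \<eta>0 (Ps1 @ Ps2) \<and> ?F (Ps1 @ Ps2) (fst u)" for u
      unfolding B by blast
    fix y assume "y \<in> ?f ` ?A"
    then show "y \<in> ?B"
      by (auto simp: A mem F join_reachable)
  qed
qed

lemma join_cube_initial:
  "join_cube (length Ps1) (declared_vars Ps1) ` initial (U (model \<eta>0 Ps1 ||| model \<eta>0 Ps2)) =
    initial (U (model \<eta>0 (Ps1 @ Ps2)))"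
proof -
  have "initial (U (model \<eta>0 Ps1 ||| model \<eta>0 Ps2)) =
      (\<lambda>(s, t). (State s, State t)) ` (initial_states \<eta>0 Ps1 \<times> initial_states \<eta>0 Ps2)"
    by (auto simp: model_def interleaving_def hda_skeleton_def hda_tensor_def)
  then show ?thesis
    by (simp add: model_def initial_states_append image_image case_prod_beta)
qed

text \<open>The relation compares process IDs. A common shift preserves and reflects their order
  within the second block, and every ID of the first block is below every shifted one, which yields
  exactly the mixed clause of the interleaving.\<close>

lemma join_label_ltimes:
  assumes "a \<in> alphabet (U (model \<eta>0 Ps1 ||| model \<eta>0 Ps2))"
    and "b \<in> alphabet (U (model \<eta>0 Ps1 ||| model \<eta>0 Ps2))"
  shows "(join_label (length Ps1) a, join_label (length Ps1) b) \<in> ltimes (model \<eta>0 (Ps1 @ Ps2)) \<longleftrightarrow>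
    (a, b) \<in> ltimes (model \<eta>0 Ps1 ||| model \<eta>0 Ps2)"
proof -
  have "((i, x), (j, y)) \<in> ltimes (model \<eta>0 Ps) \<longleftrightarrow>
      i < j \<and> j < length Ps \<and> x \<in> actions (Ps ! i) \<and> y \<in> actions (Ps ! j)"
    for i j x y and Ps :: "('v, 'd, 'l, 'a) program_graph list"
    by (simp add: model_def)
  moreover have "(i, x) \<in> alphabet (U (model \<eta>0 Ps)) \<longleftrightarrow> i < length Ps \<and> x \<in> actions (Ps ! i)"
    for i x and Ps :: "('v, 'd, 'l, 'a) program_graph list"
    by (simp add: model_def)
  ultimately show ?thesis
    using assms
    by (auto simp: interleaving_def hda_skeleton_def hda_tensor_def nth_append)
qed

section \<open>The isomorphism for disjoint systems\<close>

theorem model_append_isomorphic: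
  assumes "shared_variable_system D Var Ps1" "shared_variable_system D Var Ps2"
  shows "model \<eta>0 (Ps1 @ Ps2) \<cong>\<^sub>\<ltimes> model \<eta>0 Ps1 ||| model \<eta>0 Ps2"
proof (rule ltimes_isomorphic_bijI[OF _ _ bij_betw_join_cube bij_betw_join_label])
  let ?T = "model \<eta>0 Ps1 ||| model \<eta>0 Ps2" and ?S = "model \<eta>0 (Ps1 @ Ps2)"
  let ?f = "join_cube (length Ps1) (declared_vars Ps1)"
  have "shared_variable_system D Var (Ps1 @ Ps2)"
    using assms by (auto simp: shared_variable_system_def)
  then show "ltimes_transition_system ?S"
    by (rule ltimes_transition_system_model)
  show "ltimes_transition_system ?T"
    using assms by (intro ltimes_transition_system_interleaving ltimes_transition_system_model)
  \<comment> \<open>Degrees, boundaries and edge labels are compared by computation on each of the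
    three shapes of \<open>cubes_interleaving\<close>.\<close>
  note defs = model_def interleaving_def hda_skeleton_def precubical_skeleton_def
    hda_tensor_def precubical_tensor_def cubes_of_degree_def
  show "deg (underlying (U ?S)) (?f x) = deg (underlying (U ?T)) x"
    if "x \<in> cubes (underlying (U ?T))" for x
    using that unfolding cubes_interleaving by (auto simp: defs)
  show "?f (bd (underlying (U ?T)) k i x) = bd (underlying (U ?S)) k i (?f x)"
    if "x \<in> cubes (underlying (U ?T))" "k \<in> {0, 1}" "i \<in> {1..deg (underlying (U ?T)) x}" for x k i
    using that unfolding cubes_interleaving by (auto simp: defs)
  show "label (U ?S) (?f x) = join_label (length Ps1) (label (U ?T) x)"
    if "x \<in> cubes_of_degree (underlying (U ?T)) 1" for x
    using that unfolding cubes_of_degree_def cubes_interleaving by (auto simp: defs)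
qed (simp_all add: join_cube_initial join_cube_final join_label_ltimes)

end

theorem theorem5p1:
  fixes D :: "'v \<Rightarrow> 'd set"
    and Var :: "'v set"
    and \<eta>0 :: "'v \<Rightarrow> 'd"
    and Ps1 Ps2 :: "('v, 'd, 'l, 'a) program_graph list"
  assumes "shared_variable_system D Var Ps1"
    and "shared_variable_system D Var Ps2"
    and "\<eta>0 \<in> Ev D Var"
    and "declared_vars Ps1 \<inter> declared_vars Ps2 = {}"
  shows "model \<eta>0 (Ps1 @ Ps2) \<cong>\<^sub>\<ltimes> model \<eta>0 Ps1 ||| model \<eta>0 Ps2"
proof -
  interpret disjoint_systems Ps1 Ps2
    by standard (rule assms(4))
  show ?thesis
    by (rule model_append_isomorphic[OF assms(1,2)])
qed

end
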